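(* Let $g\in\mathbb{R}^n\setminus\{0\}$, let $H$ be a real symmetric $n\times n$ matrix, and let $\rho:\mathbb{R}\to[0,\infty]$ be a proper closed convex function with $\rho(0)=0$. Suppose that: (1) $\rho$ is nondecreasing, $\rho(t)=0$ for all $t\le 0$, and there exists $t_0>0$ with $\rho(t_0)<\infty$; (2) $\lim_{t\to\infty}\rho(t)/t=\infty$; (3) the monotone conjugate $\rho^+$ is differentiable at every $t>0$. For $t\in\mathbb{R}$ let $$\lambda(t):=\lambda_{\min}\left(\begin{bmatrix}t&g^T\\ g&H\end{bmatrix}\right),\qquad \widehat k(t):=\inf_{\gamma\ge 0}\{\rho(\gamma-1)+\gamma\lambda(t)\},$$ and let $t^*$ be a maximizer of $\sup_{t\in\mathbb{R}}\{\widehat k(t)-t\}$. (i) Suppose that $H\succ 0$ and $\|H^{-1}g\|^2\notin\operatorname{arg\,min}\rho$. Then $\lambda(t^* )<0$, and $\widehat k$ is differentiable at $t^*$. (ii) Suppose that $\lambda_{\min}(H)\le 0$, $g\in{\rm Range}(H-\lambda_{\min}(H)I)$ and $$\|(H-\lambda_{\min}(H)I)^\dagger g\|>\sqrt{(\rho^+)'_+(-\lambda_{\min}(H))}.$$ Then $\lambda(t^* )<\lambda_{\min}(H)$, and $\widehat k$ is differentiable at $t^*$.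
   Context: $\|\cdot\|$ is the Euclidean norm, $\lambda_{\min}(A)$ the smallest eigenvalue of a real symmetric matrix $A$, $A^\dagger$ the Moore-Penrose pseudoinverse, $I$ the identity matrix, $A\succ 0$ means positive definite. The monotone conjugate of $\rho$ is $\rho^+(u):=\sup_{t\ge 0}\{ut-\rho(t)\}$, and $f'_+$ denotes the right-hand derivative of $f$. *)

theory Defs
  imports "HOL-Analysis.Analysis"
begin

text \<open>Extended-valued convex functions on the real line. Closedness is closedness of
  the epigraph, equivalently lower semicontinuity on the whole line.\<close>

definition epi :: "(real \<Rightarrow> ereal) \<Rightarrow> (real \<times> real) set"
  where "epi f = {(x, r). f x \<le> ereal r}"

definition proper_closed_convex :: "(real \<Rightarrow> ereal) \<Rightarrow> bool"
  where "proper_closed_convex f \<longleftrightarrow>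
    (\<forall>x. f x \<noteq> -\<infinity>) \<and> (\<exists>x. f x \<noteq> \<infinity>) \<and> closed (epi f) \<and> convex (epi f)"

definition monotone_conj :: "(real \<Rightarrow> ereal) \<Rightarrow> real \<Rightarrow> ereal"
  where "monotone_conj f u = (SUP t\<in>{0..}. ereal (u * t) - f t)"

text \<open>Differentiability of an extended-valued function at a point requires it to be
  finite in a neighbourhood of that point.\<close>

definition ereal_differentiable_at :: "(real \<Rightarrow> ereal) \<Rightarrow> real \<Rightarrow> bool"
  where "ereal_differentiable_at f x \<longleftrightarrow>
    (\<forall>\<^sub>F y in nhds x. \<bar>f y\<bar> \<noteq> \<infinity>) \<and> (\<lambda>y. real_of_ereal (f y)) differentiable (at x)"

text \<open>Meaningful only if \<open>f\<close> is finite at \<open>x\<close> and to the right of \<open>x\<close>, and the one-sided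
  limit exists in the reals. It is applied to the monotone conjugate of a nonnegative
  superlinear function vanishing at 0, which is a finite convex function on the whole line.\<close>

definition right_deriv :: "(real \<Rightarrow> ereal) \<Rightarrow> real \<Rightarrow> real"
  where "right_deriv f x =
    (THE d. ((\<lambda>y. real_of_ereal (f y)) has_real_derivative d) (at_right x))"

definition eigenvalue_of :: "real^'n^'n \<Rightarrow> real \<Rightarrow> bool"
  where "eigenvalue_of A c \<longleftrightarrow> (\<exists>v. v \<noteq> 0 \<and> A *v v = c *\<^sub>R v)"

definition lambda_min :: "real^'n^'n \<Rightarrow> real"
  where "lambda_min A = (LEAST c. eigenvalue_of A c)"

definition positive_definite :: "real^'n^'n \<Rightarrow> bool"
  where "positive_definite A \<longleftrightarrow> transpose A = A \<and> (\<forall>x. x \<noteq> 0 \<longrightarrow> 0 < x \<bullet> (A *v x))"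

text \<open>The unique matrix satisfying the four Penrose equations.\<close>

definition pinv :: "real^'n^'m \<Rightarrow> real^'m^'n"
  where "pinv A = (THE X. A ** X ** A = A \<and> X ** A ** X = X \<and>
    transpose (A ** X) = A ** X \<and> transpose (X ** A) = X ** A)"

text \<open>The block matrix with rows \<open>(t, g\<^sup>T)\<close> and \<open>(g, H)\<close>; index \<open>None\<close> is the added first
  row and column.\<close>

definition bordered :: "real \<Rightarrow> real^'n \<Rightarrow> real^'n^'n \<Rightarrow> real^('n option)^('n option)"
  where "bordered t g H = (\<chi> i j.
    case i of
      None \<Rightarrow> (case j of None \<Rightarrow> t | Some l \<Rightarrow> g $ l)
    | Some k \<Rightarrow> (case j of None \<Rightarrow> g $ k | Some l \<Rightarrow> H $ k $ l))"

definition lam :: "real^'n \<Rightarrow> real^'n^'n \<Rightarrow> real \<Rightarrow> real"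
  where "lam g H t = lambda_min (bordered t g H)"

definition khat :: "(real \<Rightarrow> ereal) \<Rightarrow> real^'n \<Rightarrow> real^'n^'n \<Rightarrow> real \<Rightarrow> ereal"
  where "khat \<rho> g H t = (INF \<gamma>\<in>{0..}. \<rho> (\<gamma> - 1) + ereal (\<gamma> * lam g H t))"

end

theory Submission
  imports Defs
begin

text \<open>For \<open>\<lambda>(t) \<le> 0\<close> one has \<open>khat t = \<lambda>(t) - \<rho>\<^sup>+(-\<lambda>(t))\<close>. Put \<open>c = 0\<close> in part (i) and \<open>c = \<lambda>\<^sub>m\<^sub>i\<^sub>n(H)\<close> in
  part (ii). Below the value \<open>c\<close>, the function \<open>\<lambda>\<close> is the inverse of
  \<open>\<phi>(s) = s + g\<^sup>T (H - s)\<^sup>-\<^sup>1 g\<close>, whose derivative \<open>1 + |(H - s)\<^sup>-\<^sup>1 g|\<^sup>2\<close> is positive; this makes \<open>khat\<close>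
  differentiable at \<open>t\<close> as soon as \<open>\<lambda>(t) < c\<close>. The condition on \<open>g\<close> says that, at \<open>s = c\<close>, the left
  derivative of \<open>s - \<rho>\<^sup>+(-s) - \<phi>(s)\<close> is negative, so no \<open>t\<close> with \<open>\<lambda>(t) \<ge> c\<close> can be a maximizer.\<close>

subsection \<open>Smallest eigenvalues of symmetric and bordered matrices\<close>

lemma symmetric_inner:
  fixes A :: "real^'n^'n"
  assumes "transpose A = A"
  shows "x \<bullet> (A *v y) = (A *v x) \<bullet> y"
  by (metis assms dot_lmul_matrix vector_transpose_matrix)

text \<open>If \<open>w = A *v v\<close> were nonzero, moving from \<open>v\<close> a little in
  direction \<open>-w\<close> would make the form negative: its value there is
  \<open>r * r * m - 2 * r * (w \<bullet> w)\<close>, whose linear term dominates for small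
  \<open>r\<close>.\<close>

lemma psd_zero:
  fixes A :: "real^'n^'n"
  assumes sym: "transpose A = A" and psd: "\<And>x. 0 \<le> x \<bullet> (A *v x)" and z: "v \<bullet> (A *v v) = 0"
  shows "A *v v = 0"
proof (rule ccontr)
  define w where "w = A *v v"
  define m where "m = w \<bullet> (A *v w)"
  assume "A *v v \<noteq> 0"
  then have w: "w \<bullet> w > 0" by (simp add: w_def)
  have m: "m \<ge> 0" using psd by (simp add: m_def)
  \<comment> \<open>The \<open>+ 1\<close> keeps the denominator positive when \<open>m = 0\<close>
    and still gives \<open>r * m < w \<bullet> w\<close>.\<close>
  define r where "r = (w \<bullet> w) / (m + 1)"
  have r: "r > 0" using w m by (simp add: r_def)
  have "r * m + r = w \<bullet> w" using m by (simp add: r_def add_divide_distrib[symmetric] field_simps)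
  then have rm: "r * m - 2 * (w \<bullet> w) < 0" using r w by linarith
  have "0 \<le> (v - r *\<^sub>R w) \<bullet> (A *v (v - r *\<^sub>R w))" by (rule psd)
  also have "\<dots> = v \<bullet> (A *v v) - r * (v \<bullet> (A *v w)) - r * (w \<bullet> (A *v v)) + r * r * m"
    by (simp add: matrix_vector_mult_diff_distrib inner_diff_left inner_diff_right
        matrix_vector_mult_scaleR m_def algebra_simps)
  also have "\<dots> = r * (r * m - 2 * (w \<bullet> w))"
    using symmetric_inner[OF sym, of v w] z by (simp add: w_def[symmetric] algebra_simps)
  also have "\<dots> < 0" using r rm by (rule mult_pos_neg)
  finally show False by simp
qed

text \<open>The form attains a minimum \<open>c\<close> on the compact unit sphere, and scaling
  extends the bound to all vectors. Then \<open>A - c I\<close> is positive semidefinite and its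
  form vanishes at the minimizer, so \<open>psd_zero\<close> makes the minimizer an
  eigenvector.\<close>

lemma symmetric_min_eigenpair:
  fixes A :: "real^'n^'n"
  assumes sym: "transpose A = A"
  obtains c v where "v \<noteq> 0" "A *v v = c *\<^sub>R v" "\<And>x. c * (x \<bullet> x) \<le> x \<bullet> (A *v x)"
proof -
  have "continuous_on (sphere 0 1) (\<lambda>x. x \<bullet> (A *v x))"
    by (intro continuous_intros linear_continuous_on) (simp add: linear_linear)
  moreover have "sphere (0::real^'n) 1 \<noteq> {}" by simp
  ultimately have "\<exists>v\<in>sphere 0 1. \<forall>x\<in>sphere 0 1. v \<bullet> (A *v v) \<le> x \<bullet> (A *v x)"
    by (intro continuous_attains_inf) auto
  then obtain v where v: "norm v = 1"
    and min: "\<And>x. norm x = 1 \<Longrightarrow> v \<bullet> (A *v v) \<le> x \<bullet> (A *v x)"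
    by auto
  define c where "c = v \<bullet> (A *v v)"
  have le: "c * (x \<bullet> x) \<le> x \<bullet> (A *v x)" for x
  proof (cases "x = 0")
    case False
    define y where "y = x /\<^sub>R norm x"
    have "x = norm x *\<^sub>R y" and y: "norm y = 1" using False by (simp_all add: y_def)
    have "x \<bullet> (A *v x) = (norm x *\<^sub>R y) \<bullet> (A *v (norm x *\<^sub>R y))"
      using \<open>x = norm x *\<^sub>R y\<close> by simp
    also have "\<dots> = (norm x)\<^sup>2 * (y \<bullet> (A *v y))"
      by (simp add: matrix_vector_mult_scaleR power2_eq_square)
    also have "\<dots> \<ge> (norm x)\<^sup>2 * c"
      using min[OF y] by (intro mult_left_mono) (simp_all add: c_def)
    finally show ?thesis by (simp add: dot_square_norm mult.commute)
  qed simp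
  define B where "B = A - c *\<^sub>R mat 1"
  have Bv: "B *v x = A *v x - c *\<^sub>R x" for x
    by (simp add: B_def matrix_vector_mult_diff_rdistrib scaleR_matrix_vector_assoc[symmetric])
  have "transpose B = B"
    using sym by (simp add: B_def transpose_def vec_eq_iff mat_def)
  then have "B *v v = 0"
    by (rule psd_zero) (use le v in \<open>simp_all add: Bv inner_diff_right c_def norm_eq_1\<close>)
  moreover have "v \<noteq> 0" using v by auto
  ultimately show thesis
    using that[of v c] le by (simp add: Bv)
qed

text \<open>A certificate for the \<open>LEAST\<close> in \<open>lambda_min\<close>: the eigenvector
  shows that \<open>c\<close> belongs to the set, and the form bound, tested on any other
  eigenvector, shows that nothing smaller does.\<close>

lemma lambda_min_eqI:
  assumes "v \<noteq> 0" "A *v v = c *\<^sub>R v" "\<And>x. c * (x \<bullet> x) \<le> x \<bullet> (A *v x)"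
  shows "lambda_min A = c"
  unfolding lambda_min_def
proof (rule Least_equality)
  show "eigenvalue_of A c" using assms by (auto simp: eigenvalue_of_def)
  fix d assume "eigenvalue_of A d"
  then obtain w where w: "w \<noteq> 0" "A *v w = d *\<^sub>R w" by (auto simp: eigenvalue_of_def)
  then have "c * (w \<bullet> w) \<le> d * (w \<bullet> w)" using assms(3)[of w] by simp
  with w show "c \<le> d" by (simp add: mult_le_cancel_right_pos)
qed

lemma lambda_min_symmetric:
  assumes "transpose A = A"
  shows "lambda_min A * (x \<bullet> x) \<le> x \<bullet> (A *v x)"
    and "\<exists>v. v \<noteq> 0 \<and> A *v v = lambda_min A *\<^sub>R v"
proof -
  obtain c v where *: "v \<noteq> 0" "A *v v = c *\<^sub>R v" "\<And>x. c * (x \<bullet> x) \<le> x \<bullet> (A *v x)"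
    using symmetric_min_eigenpair[OF assms] by blast
  then have "lambda_min A = c" by (rule lambda_min_eqI)
  with * show "lambda_min A * (x \<bullet> x) \<le> x \<bullet> (A *v x)"
    and "\<exists>v. v \<noteq> 0 \<and> A *v v = lambda_min A *\<^sub>R v" by auto
qed

section \<open>Block vectors and the smallest eigenvalue of the bordered matrix\<close>

definition vjoin :: "real \<Rightarrow> real^'n \<Rightarrow> real^('n option)"
  where "vjoin a x = (\<chi> i. case i of None \<Rightarrow> a | Some k \<Rightarrow> x $ k)"

lemma sum_option: "(\<Sum>i\<in>UNIV. f i) = f None + (\<Sum>k\<in>UNIV. f (Some k :: 'n::finite option))"
  by (simp add: UNIV_option_conv sum.reindex)

lemma vjoin_cases: obtains a x where "z = vjoin a x"
proof
  show "z = vjoin (z $ None) (\<chi> k. z $ Some k)"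
    by (simp add: vjoin_def vec_eq_iff split: option.split)
qed

lemma vjoin_eq_iff: "vjoin a x = vjoin b y \<longleftrightarrow> a = b \<and> x = y"
  by (auto simp: vjoin_def vec_eq_iff split: option.split)

lemma vjoin_eq_0_iff: "vjoin a x = 0 \<longleftrightarrow> a = 0 \<and> x = 0"
  by (auto simp: vjoin_def vec_eq_iff split: option.split)

lemma scaleR_vjoin: "r *\<^sub>R vjoin a x = vjoin (r * a) (r *\<^sub>R x)"
  by (simp add: vjoin_def vec_eq_iff split: option.split)

lemma inner_vjoin: "vjoin a x \<bullet> vjoin b y = a * b + x \<bullet> y"
  by (simp add: vjoin_def inner_vec_def sum_option)

lemma bordered_vjoin:
  "bordered t g H *v vjoin a x = vjoin (t * a + g \<bullet> x) (a *\<^sub>R g + H *v x)"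
  by (simp add: bordered_def vjoin_def matrix_vector_mult_def vec_eq_iff sum_option inner_vec_def
      mult.commute split: option.split)

lemma bordered_sym: "transpose H = H \<Longrightarrow> transpose (bordered t g H) = bordered t g H"
  by (simp add: bordered_def transpose_def vec_eq_iff split: option.split)

lemma bordered_quad:
  "vjoin a x \<bullet> (bordered t g H *v vjoin a x) = t * a\<^sup>2 + 2 * a * (g \<bullet> x) + x \<bullet> (H *v x)"
  by (simp add: bordered_vjoin inner_vjoin power2_eq_square inner_add_right inner_commute algebra_simps)

lemma lam_le:
  assumes "transpose H = H"
  shows "lam g H t * (a\<^sup>2 + x \<bullet> x) \<le> t * a\<^sup>2 + 2 * a * (g \<bullet> x) + x \<bullet> (H *v x)"
  using lambda_min_symmetric(1)[OF bordered_sym[OF assms], of t g "vjoin a x"]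
  by (simp add: bordered_quad lam_def inner_vjoin power2_eq_square)

text \<open>The vector \<open>(1, -x)\<close> is an eigenvector for \<open>s\<close>. Minimality
  follows by completing the square: with \<open>w = y + a x\<close>, the form of the bordered matrix
  minus \<open>s\<close> at \<open>(a, y)\<close> equals the form of \<open>H - s\<close> at
  \<open>w\<close>.\<close>

lemma lam_eqI:
  fixes H :: "real^'n^'n"
  assumes sym: "transpose H = H" and low: "\<And>x. s * (x \<bullet> x) \<le> x \<bullet> (H *v x)"
    and x: "H *v x - s *\<^sub>R x = g" and t: "t = s + g \<bullet> x"
  shows "lam g H t = s"
  unfolding lam_def
proof (rule lambda_min_eqI)
  show "vjoin 1 (- x) \<noteq> 0" by (simp add: vjoin_eq_0_iff)
  have "H *v (- x) = - (H *v x)"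
    using matrix_vector_mult_diff_distrib[of H 0 x] by simp
  then show "bordered t g H *v vjoin 1 (- x) = s *\<^sub>R vjoin 1 (- x)"
    using x t by (auto simp: bordered_vjoin scaleR_vjoin vjoin_eq_iff)
  fix z :: "real^('n option)"
  obtain a y where z: "z = vjoin a y" by (rule vjoin_cases)
  define w where "w = y + a *\<^sub>R x"
  have y: "y = w - a *\<^sub>R x" by (simp add: w_def)
  have Hx: "H *v x = g + s *\<^sub>R x" using x by (simp add: algebra_simps)
  have xH: "x \<bullet> (H *v w) = (g + s *\<^sub>R x) \<bullet> w"
    using symmetric_inner[OF sym, of x w] Hx by simp
  have "z \<bullet> (bordered t g H *v z) - s * (z \<bullet> z) = w \<bullet> (H *v w) - s * (w \<bullet> w)"
    unfolding z bordered_quad inner_vjoin y t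
    by (simp add: matrix_vector_mult_diff_distrib matrix_vector_mult_scaleR inner_diff_left
        inner_diff_right inner_add_left inner_add_right xH Hx inner_commute power2_eq_square algebra_simps)
  then show "s * (z \<bullet> z) \<le> z \<bullet> (bordered t g H *v z)" using low[of w] by linarith
qed

text \<open>Converse of \<open>lam_eqI\<close>. An eigenvector with first entry 0 would be an
  eigenvector of \<open>H\<close> for a value below \<open>c\<close>, which \<open>low\<close>
  excludes; rescaling the first entry to -1 turns the remaining block into the solution
  \<open>x\<close>.\<close>

lemma lam_solution:
  assumes sym: "transpose H = H" and low: "\<And>x. c * (x \<bullet> x) \<le> x \<bullet> (H *v x)"
    and lt: "lam g H t < c"
  obtains x where "H *v x - lam g H t *\<^sub>R x = g" "t = lam g H t + g \<bullet> x"
proof -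
  define s where "s = lam g H t"
  obtain z where z: "z \<noteq> 0" "bordered t g H *v z = s *\<^sub>R z"
    using lambda_min_symmetric(2)[OF bordered_sym[OF sym]] unfolding s_def lam_def by blast
  obtain a y where zy: "z = vjoin a y" by (rule vjoin_cases)
  have e: "t * a + g \<bullet> y = s * a" "a *\<^sub>R g + H *v y = s *\<^sub>R y"
    using z(2) by (auto simp: zy bordered_vjoin scaleR_vjoin vjoin_eq_iff)
  have a: "a \<noteq> 0"
  proof
    assume a: "a = 0"
    with z(1) have "y \<bullet> y > 0" by (simp add: zy vjoin_eq_0_iff)
    moreover have "c * (y \<bullet> y) \<le> s * (y \<bullet> y)" using low[of y] e a by simp
    ultimately show False using lt by (simp add: s_def)
  qed
  define b where "b = - 1 / a"
  have b: "b * a = - 1" using a by (simp add: b_def)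
  define x where "x = b *\<^sub>R y"
  have "H *v x - s *\<^sub>R x = b *\<^sub>R (H *v y - s *\<^sub>R y)"
    by (simp add: x_def matrix_vector_mult_scaleR algebra_simps)
  also have "H *v y - s *\<^sub>R y = - (a *\<^sub>R g)" using e(2) by (simp add: algebra_simps)
  finally have "H *v x - s *\<^sub>R x = g" using b by simp
  moreover have "t = s + g \<bullet> x" using e(1) a by (simp add: x_def b_def field_simps)
  ultimately show thesis unfolding s_def by (rule that)
qed

text \<open>The minimal eigenvector at \<open>r'\<close> serves as a test vector at
  \<open>r\<close>. Only the corner entry differs, so the form changes by
  \<open>(r - r') * a\<^sup>2\<close>, and \<open>a\<^sup>2\<close> is at most the squared norm of
  the vector.\<close>

lemma lam_mono:
  assumes sym: "transpose H = H" and "t \<le> u"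
  shows "lam g H t \<le> lam g H u" "lam g H u \<le> lam g H t + (u - t)"
proof -
  have *: "lam g H r \<le> lam g H r' + max 0 (r - r')" for r r'
  proof -
    obtain z where z: "z \<noteq> 0" "bordered r' g H *v z = lam g H r' *\<^sub>R z"
      using lambda_min_symmetric(2)[OF bordered_sym[OF sym]] unfolding lam_def by blast
    obtain a y where zy: "z = vjoin a y" by (rule vjoin_cases)
    have pos: "a\<^sup>2 + y \<bullet> y > 0"
      using z(1) inner_gt_zero_iff[of z] by (simp add: zy inner_vjoin power2_eq_square)
    have "r' * a\<^sup>2 + 2 * a * (g \<bullet> y) + y \<bullet> (H *v y) = lam g H r' * (a\<^sup>2 + y \<bullet> y)"
      using z(2) bordered_quad[of a y r' g H] by (simp add: zy inner_vjoin power2_eq_square)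
    moreover have "(r - r') * a\<^sup>2 \<le> max 0 (r - r') * (a\<^sup>2 + y \<bullet> y)"
      by (intro mult_mono) auto
    ultimately have "lam g H r * (a\<^sup>2 + y \<bullet> y) \<le> (lam g H r' + max 0 (r - r')) * (a\<^sup>2 + y \<bullet> y)"
      using lam_le[OF sym, of g r a y] by (simp add: algebra_simps)
    then show ?thesis using pos by (simp add: mult_le_cancel_right_pos)
  qed
  show "lam g H t \<le> lam g H u" "lam g H u \<le> lam g H t + (u - t)"
    using *[of t u] *[of u t] assms(2) by (simp_all add: max_absorb1 max_absorb2)
qed

lemma isCont_lam:
  assumes "transpose H = H"
  shows "isCont (lam g H) t"
proof -
  have "dist (lam g H u) (lam g H t) \<le> dist u t" for u
    using lam_mono[OF assms, of u t g] lam_mono[OF assms, of t u g]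
    by (cases "t \<le> u") (simp_all add: dist_real_def)
  then show ?thesis
    unfolding continuous_at_eps_delta by (intro allI impI) (meson le_less_trans)
qed

section \<open>Resolvent of \<open>H\<close> below a lower bound of its form, and differentiability
  of \<open>lam\<close>\<close>

lemma resolvent_bound:
  assumes low: "\<And>x. c * (x \<bullet> x) \<le> x \<bullet> (H *v x)"
  shows "(c - s) * norm x \<le> norm (H *v x - s *\<^sub>R x)"
proof (cases "x = 0")
  case False
  have "(c - s) * norm x * norm x = c * (x \<bullet> x) - s * (x \<bullet> x)"
    by (simp add: dot_square_norm power2_eq_square left_diff_distrib)
  also have "\<dots> \<le> x \<bullet> (H *v x - s *\<^sub>R x)"
    using low[of x] by (simp add: inner_diff_right)
  also have "\<dots> \<le> norm (H *v x - s *\<^sub>R x) * norm x"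
    using norm_cauchy_schwarz[of x "H *v x - s *\<^sub>R x"] by (simp add: mult.commute)
  finally show ?thesis using False by simp
qed simp

lemma resolvent_exists:
  fixes H :: "real^'n^'n"
  assumes low: "\<And>x. c * (x \<bullet> x) \<le> x \<bullet> (H *v x)" and "s < c"
  shows "\<exists>x. H *v x - s *\<^sub>R x = g"
proof -
  define f where "f = (\<lambda>x. H *v x - s *\<^sub>R x)"
  have lin: "linear f" unfolding f_def
    by (intro linear_compose_sub matrix_vector_mul_linear linear_scale_self)
  have "inj f"
    unfolding linear_injective_0[OF lin]
  proof (intro allI impI)
    fix x assume "f x = 0"
    then have "(c - s) * norm x \<le> 0" using resolvent_bound[OF low, of s x] by (simp add: f_def)
    then show "x = 0" using assms(2) by (simp add: mult_le_0_iff)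
  qed
  then have "surj f" using lin by (simp add: linear_injective_imp_surjective)
  then show ?thesis unfolding f_def surj_def by metis
qed

text \<open>The resolvent identity paired with \<open>g\<close>. It expresses difference quotients
  of \<open>g \<bullet> x\<close> as inner products of two resolvent solutions, so continuity of the
  resolvent alone yields the derivative of \<open>phi\<close>.\<close>

lemma resolvent_inner_diff:
  fixes H :: "real^'n^'n"
  assumes sym: "transpose H = H"
    and "H *v x - s *\<^sub>R x = g" "H *v y - r *\<^sub>R y = g"
  shows "g \<bullet> y - g \<bullet> x = (r - s) * (x \<bullet> y)"
proof -
  have "g \<bullet> y = (H *v x) \<bullet> y - s * (x \<bullet> y)" using assms(2) by (auto simp: inner_diff_left)
  moreover have "g \<bullet> x = (H *v y) \<bullet> x - r * (x \<bullet> y)"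
    using assms(3) by (auto simp: inner_diff_left inner_diff_right inner_commute)
  ultimately show ?thesis using symmetric_inner[OF sym, of x y]
    by (simp add: inner_commute algebra_simps)
qed

text \<open>Below \<open>c\<close>, \<open>phi\<close> is a left inverse of \<open>lam\<close> with
  derivative \<open>1 + X s \<bullet> X s\<close>, at least 1; continuity of \<open>lam\<close> then
  allows the inverse function rule.\<close>

lemma lam_differentiable:
  fixes H :: "real^'n^'n"
  assumes sym: "transpose H = H" and low: "\<And>x. c * (x \<bullet> x) \<le> x \<bullet> (H *v x)"
    and lt: "lam g H t < c"
  shows "lam g H differentiable at t"
proof -
  have "\<exists>x. s < c \<longrightarrow> H *v x - s *\<^sub>R x = g" for s
    using resolvent_exists[OF low, of s g] by blast
  then obtain X where X: "\<And>s. s < c \<Longrightarrow> H *v X s - s *\<^sub>R X s = g"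
    by metis
  define phi where "phi = (\<lambda>s. s + g \<bullet> X s)"
  have phi: "phi (lam g H u) = u" if lu: "lam g H u < c" for u
  proof -
    obtain x where x: "H *v x - lam g H u *\<^sub>R x = g" "u = lam g H u + g \<bullet> x"
      using lam_solution[OF sym low lu] by blast
    have "(c - lam g H u) * norm (x - X (lam g H u)) \<le> 0"
      using resolvent_bound[OF low, of "lam g H u" "x - X (lam g H u)"] x(1) X[OF lu]
      by (simp add: matrix_vector_mult_diff_distrib algebra_simps)
    then have "x = X (lam g H u)" using lu by (simp add: mult_le_0_iff)
    then have "phi (lam g H u) = lam g H u + g \<bullet> x" by (simp add: phi_def)
    also have "\<dots> = u" by (rule x(2)[symmetric])
    finally show ?thesis .
  qed
  define s where "s = lam g H t"
  have s: "s < c" using lt by (simp add: s_def)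
  have ev: "\<forall>\<^sub>F r in at s. r < c"
    using s by (rule order_tendstoD(2)[OF tendsto_ident_at])
  have Xlim: "(X \<longlongrightarrow> X s) (at s)"
  proof (rule Lim_null[THEN iffD2], rule Lim_null_comparison)
    show "((\<lambda>r. \<bar>s - r\<bar> * (norm (X s) / (c - r))) \<longlongrightarrow> 0) (at s)"
      using s by (auto intro!: tendsto_eq_intros)
    show "\<forall>\<^sub>F r in at s. norm (X r - X s) \<le> \<bar>s - r\<bar> * (norm (X s) / (c - r))"
      using ev
    proof eventually_elim
      case (elim r)
      \<comment> \<open>The difference of two resolvent solutions solves a resolvent equation with
        right side of order \<open>r - s\<close>, so \<open>resolvent_bound\<close> gives
        continuity.\<close>
      have "H *v (X r - X s) - r *\<^sub>R (X r - X s) = (r - s) *\<^sub>R X s"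
        using X[OF elim] X[OF s] by (simp add: matrix_vector_mult_diff_distrib algebra_simps)
      then have "(c - r) * norm (X r - X s) \<le> \<bar>r - s\<bar> * norm (X s)"
        using resolvent_bound[OF low, of r "X r - X s"] by simp
      then show ?case using elim by (simp add: field_simps abs_minus_commute)
    qed
  qed
  have "((\<lambda>r. 1 + X s \<bullet> X r) \<longlongrightarrow> 1 + X s \<bullet> X s) (at s)"
    by (intro tendsto_intros Xlim)
  moreover have "\<forall>\<^sub>F r in at s. 1 + X s \<bullet> X r = (phi r - phi s) / (r - s)"
    using ev eventually_neq_at_within[of s]
  proof eventually_elim
    case (elim r)
    have "phi r - phi s = (r - s) * (1 + X s \<bullet> X r)"
      using resolvent_inner_diff[OF sym X[OF s] X[OF elim(1)]]
      by (simp add: phi_def algebra_simps)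
    then show ?case using elim by simp
  qed
  ultimately have D: "(phi has_field_derivative (1 + X s \<bullet> X s)) (at s)"
    unfolding has_field_derivative_iff by (rule Lim_transform_eventually)
  have "\<forall>\<^sub>F u in nhds t. lam g H u < c"
    using isCont_lam[OF sym, of t g] lt
    by (simp add: continuous_within order_tendstoD eventually_nhds_conv_at)
  then obtain e where e: "e > 0" "\<And>u. dist u t < e \<Longrightarrow> lam g H u < c"
    by (auto simp: eventually_nhds_metric)
  have "DERIV (lam g H) t :> inverse (1 + X s \<bullet> X s)"
  proof (rule DERIV_inverse_function)
    show "DERIV phi (lam g H t) :> 1 + X s \<bullet> X s" using D by (simp add: s_def)
    show "1 + X s \<bullet> X s \<noteq> 0" using inner_ge_zero[of "X s"] by linarith
    show "t - e < t" "t < t + e" using e by auto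
    show "phi (lam g H u) = u" if "t - e < u" "u < t + e" for u
      using that by (intro phi e) (auto simp: dist_real_def)
    show "isCont (lam g H) t" by (rule isCont_lam[OF sym])
  qed
  then show ?thesis by (auto simp: real_differentiable_def)
qed

subsection \<open>The monotone conjugate\<close>

lemma monotone_conj_upper: "0 \<le> t \<Longrightarrow> ereal (u * t) - f t \<le> monotone_conj f u"
  unfolding monotone_conj_def by (rule SUP_upper) simp

lemma monotone_conj_leI:
  assumes "\<And>t r. 0 \<le> t \<Longrightarrow> f t = ereal r \<Longrightarrow> u * t - r \<le> b" and nonneg: "\<And>t. 0 \<le> f t"
  shows "monotone_conj f u \<le> ereal b"
  unfolding monotone_conj_def
proof (rule SUP_least)
  fix t :: real assume t: "t \<in> {0..}"
  show "ereal (u * t) - f t \<le> ereal b"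
    using assms(1)[of t] nonneg[of t] t by (cases "f t") auto
qed

text \<open>Superlinearity makes \<open>u * t - f t\<close> negative beyond some \<open>T\<close>,
  so only a bounded range of \<open>t\<close> can contribute positive values to the
  supremum.\<close>

lemma monotone_conj_real:
  assumes nonneg: "\<And>t. 0 \<le> f t" and zero: "f 0 = 0"
    and super: "((\<lambda>t. f t / ereal t) \<longlongrightarrow> \<infinity>) at_top"
  obtains h where "\<And>u. monotone_conj f u = ereal (h u)" "\<And>u. 0 \<le> h u" "\<And>u. u \<le> 0 \<Longrightarrow> h u = 0"
proof -
  have ge: "0 \<le> monotone_conj f u" for u
    using monotone_conj_upper[of 0 u f] zero by (simp flip: zero_ereal_def)
  have "\<exists>b. monotone_conj f u \<le> ereal b" for u
  proof -
    have "\<forall>\<^sub>F t in at_top. ereal u < f t / ereal t"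
      using order_tendstoD(1)[OF super] by simp
    then obtain T where T: "\<And>t. t \<ge> T \<Longrightarrow> ereal u < f t / ereal t"
      by (auto simp: eventually_at_top_linorder)
    have "monotone_conj f u \<le> ereal (\<bar>u\<bar> * \<bar>T\<bar>)"
    proof (rule monotone_conj_leI[OF _ nonneg])
      fix t r :: real assume t: "0 \<le> t" "f t = ereal r"
      have r: "r \<ge> 0" using nonneg[of t] t by simp
      show "u * t - r \<le> \<bar>u\<bar> * \<bar>T\<bar>"
      proof (cases "t \<le> \<bar>T\<bar>")
        case True
        have "u * t \<le> \<bar>u\<bar> * \<bar>T\<bar>" using True t by (intro mult_mono) auto
        then show ?thesis using r by simp
      next
        case False
        then have "t > 0" by linarith
        then have "u < r / t" using False T[of t] t by simp
        then have "u * t < r" using False t by (simp add: field_simps)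
        then show ?thesis by (smt (verit) abs_ge_zero mult_nonneg_nonneg)
      qed
    qed
    then show ?thesis ..
  qed
  then have "\<exists>h. monotone_conj f u = ereal h \<and> 0 \<le> h" for u
    using ge[of u] by (cases "monotone_conj f u") (auto, metis ereal_infty_less_eq(1) PInfty_neq_ereal(1))
  then obtain h where h: "\<And>u. monotone_conj f u = ereal (h u)" "\<And>u. 0 \<le> h u" by metis
  have "h u = 0" if "u \<le> 0" for u
  proof -
    have "monotone_conj f u \<le> ereal 0"
      by (rule monotone_conj_leI[OF _ nonneg])
        (use that nonneg in \<open>smt (verit) ereal_less_eq(5) mult_nonneg_nonneg mult_minus_left\<close>)
    then show ?thesis using h[of u] by simp
  qed
  then show thesis using that h by blast
qed

text \<open>Slopes of the conjugate from the origin increase. Multiplying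
  \<open>v * t - r \<le> h v\<close> by \<open>u / v\<close> suffices, because
  \<open>r \<ge> 0\<close> and \<open>u / v \<le> 1\<close>.\<close>

lemma monotone_conj_slope_mono:
  assumes nonneg: "\<And>t. 0 \<le> f t" and h: "\<And>u. monotone_conj f u = ereal (h u)"
    and uv: "0 < u" "u \<le> v"
  shows "h u / u \<le> h v / v"
proof -
  have "monotone_conj f u \<le> ereal (u * (h v / v))"
  proof (rule monotone_conj_leI[OF _ nonneg])
    fix t r :: real assume t: "0 \<le> t" "f t = ereal r"
    have r: "r \<ge> 0" using nonneg[of t] t by simp
    have "v * t - r \<le> h v" using monotone_conj_upper[of t v f] t h by simp
    then have "u * (v * t - r) \<le> u * h v" using uv by simp
    moreover have "u * r \<le> v * r" using uv r by (simp add: mult_right_mono)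
    ultimately show "u * t - r \<le> u * (h v / v)" using uv by (simp add: field_simps)
  qed
  then show ?thesis using h uv by (simp add: field_simps)
qed

text \<open>Covers the case \<open>lambda_min H = 0\<close> of part (ii), where differentiability at
  positive points says nothing. Monotone nonnegative slopes converge to their infimum.\<close>

lemma monotone_conj_right_deriv_at_0:
  assumes nonneg: "\<And>t. 0 \<le> f t" and h: "\<And>u. monotone_conj f u = ereal (h u)"
    and "\<And>u. 0 \<le> h u" and h0: "h 0 = 0"
  shows "\<exists>d. (h has_real_derivative d) (at_right 0)"
proof -
  define d where "d = Inf ((\<lambda>u. h u / u) ` {0<..})"
  have bdd: "bdd_below ((\<lambda>u. h u / u) ` {0<..})"
    using assms(3) by (auto intro!: bdd_belowI2[of _ 0])
  have "((\<lambda>u. h u / u) \<longlongrightarrow> d) (at_right 0)"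
  proof (rule order_tendstoI)
    fix a assume "a < d"
    have "d \<le> h u / u" if "u > 0" for u
      unfolding d_def using that by (intro cINF_lower bdd) simp
    then show "\<forall>\<^sub>F u in at_right 0. a < h u / u"
      using \<open>a < d\<close> unfolding eventually_at_right_field by (intro exI[of _ 1]) force
  next
    fix a assume "d < a"
    then obtain v where v: "v > 0" "h v / v < a"
      unfolding d_def using cINF_less_iff[OF _ bdd] by auto
    have "\<forall>u>0. u < v \<longrightarrow> h u / u < a"
      using monotone_conj_slope_mono[OF nonneg h, of _ v] v by force
    then show "\<forall>\<^sub>F u in at_right 0. h u / u < a"
      unfolding eventually_at_right_field using v by blast
  qed
  then show ?thesis using h0 by (auto simp: has_field_derivative_iff)
qed

text \<open>Limits along \<open>at_right u\<close> are unique, so an existing right derivative is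
  what the definite description in \<open>right_deriv\<close> denotes.\<close>

lemma monotone_conj_right_deriv:
  assumes h: "\<And>u. monotone_conj f u = ereal (h u)"
    and ex: "\<exists>d. (h has_real_derivative d) (at_right u)"
  shows "(h has_real_derivative right_deriv (monotone_conj f) u) (at_right u)"
proof -
  obtain d where d: "(h has_real_derivative d) (at_right u)" using ex ..
  have "right_deriv (monotone_conj f) u = d"
    unfolding right_deriv_def
  proof (rule the_equality)
    show "((\<lambda>y. real_of_ereal (monotone_conj f y)) has_real_derivative d) (at_right u)"
      using d by (simp add: h)
    fix d' assume "((\<lambda>y. real_of_ereal (monotone_conj f y)) has_real_derivative d') (at_right u)"
    with d show "d' = d"
      unfolding has_field_derivative_iff h real_of_ereal.simps
      by (intro tendsto_unique[OF trivial_limit_at_right_real])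
  qed
  with d show ?thesis by simp
qed

lemma right_derivative_increment_le:
  assumes "(h has_real_derivative d) (at_right u)" "d < D"
  shows "\<forall>\<^sub>F \<delta> in at_right 0. h (u + \<delta>) - h u \<le> D * \<delta>"
proof -
  have "((\<lambda>y. (h y - h u) / (y - u)) \<longlongrightarrow> d) (at_right u)"
    using assms(1) by (simp add: has_field_derivative_iff)
  then have "\<forall>\<^sub>F y in at_right u. (h y - h u) / (y - u) < D"
    using assms(2) by (rule order_tendstoD)
  then have "\<forall>\<^sub>F \<delta> in at_right 0. (h (u + \<delta>) - h u) / \<delta> < D"
    by (subst (asm) eventually_at_right_to_0) (simp add: add.commute)
  then show ?thesis using eventually_at_right_less[of 0]
    by eventually_elim (simp add: field_simps)
qed

text \<open>Turns the condition of part (i) into a slope bound. Closedness keeps \<open>f\<close>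
  above some \<open>m > 0\<close> at a point \<tau> slightly left of \<open>a\<close>; convexity and
  \<open>f 0 = 0\<close> then force \<open>f t \<ge> m * t / \<tau>\<close> for
  \<open>t \<ge> \<tau>\<close>. For \<delta> below \<open>m / \<tau>\<close>, points beyond \<tau>
  contribute nothing positive, and points up to \<tau> contribute at most
  \<open>\<tau> * \<delta>\<close>.\<close>

lemma monotone_conj_slope_at_0:
  assumes closed: "closed (epi f)" and conv: "convex (epi f)" and nonneg: "\<And>t. 0 \<le> f t"
    and zero: "f 0 = 0" and h: "\<And>u. monotone_conj f u = ereal (h u)" and a: "0 < a" "0 < f a"
  shows "\<exists>D<a. \<forall>\<^sub>F \<delta> in at_right 0. h \<delta> \<le> D * \<delta>"
proof -
  obtain m where m: "0 < m" "ereal m < f a"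
    using ereal_dense2[OF a(2)] by (auto simp: zero_ereal_def)
  \<comment> \<open>This is lower semicontinuity: the preimage is the sublevel set of
    \<open>f\<close> at level \<open>m\<close>, and its complement is the set where \<open>f\<close>
    exceeds \<open>m\<close>.\<close>
  have "open (- ((\<lambda>x. (x, m)) -` epi f))"
    by (intro open_Compl closed_vimage closed continuous_intros)
  moreover have "a \<in> - ((\<lambda>x. (x, m)) -` epi f)" using m by (simp add: epi_def)
  ultimately have "\<forall>\<^sub>F x in at_left a. x \<in> - ((\<lambda>x. (x, m)) -` epi f)"
    by (rule topological_tendstoD[OF tendsto_ident_at])
  then have "\<forall>\<^sub>F x in at_left a. x \<in> - ((\<lambda>x. (x, m)) -` epi f) \<and> x \<in> {0<..<a}"
    using eventually_at_left_real[OF a(1)] by (rule eventually_conj)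
  then have "\<exists>x. x \<in> - ((\<lambda>x. (x, m)) -` epi f) \<and> x \<in> {0<..<a}"
    by (rule eventually_happens'[rotated]) simp
  then obtain \<tau> where \<tau>: "0 < \<tau>" "\<tau> < a" "ereal m < f \<tau>"
    by (auto simp: epi_def not_le)
  have "h \<delta> \<le> \<tau> * \<delta>" if \<delta>: "0 < \<delta>" "\<delta> < m / \<tau>" for \<delta>
  proof -
    have "monotone_conj f \<delta> \<le> ereal (\<tau> * \<delta>)"
    proof (rule monotone_conj_leI[OF _ nonneg])
      fix t r :: real assume t: "0 \<le> t" "f t = ereal r"
      have r: "r \<ge> 0" using nonneg[of t] t by simp
      show "\<delta> * t - r \<le> \<tau> * \<delta>"
      proof (cases "t \<le> \<tau>")
        case True
        then have "\<delta> * t \<le> \<delta> * \<tau>" using \<delta> by simp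
        then show ?thesis using r by (simp add: mult.commute)
      next
        case False
        then have t0: "t > 0" using \<tau> by linarith
        have "(0, 0) \<in> epi f" "(t, r) \<in> epi f"
          using zero t by (simp_all add: epi_def flip: zero_ereal_def)
        \<comment> \<open>The point \<tau> is written as a convex combination of 0 and
          \<open>t\<close>.\<close>
        then have "(1 - \<tau> / t) *\<^sub>R (0, 0) + (\<tau> / t) *\<^sub>R (t, r) \<in> epi f"
          by (rule convexD[OF conv]) (use False \<tau> t0 in auto)
        then have "f \<tau> \<le> ereal (\<tau> / t * r)" using t0 by (simp add: epi_def)
        with \<tau>(3) have "ereal m < ereal (\<tau> / t * r)" by (rule less_le_trans)
        then have "m * t < \<tau> * r" using t0 by (simp add: field_simps)
        moreover have "\<tau> * \<delta> * t \<le> m * t"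
          using \<delta> \<tau> t0 by (simp add: field_simps)
        ultimately have "\<tau> * (\<delta> * t) < \<tau> * r" by (simp add: mult.assoc)
        then have "\<delta> * t < r" using \<tau> by simp
        moreover have "0 < \<tau> * \<delta>" using \<tau> \<delta> by simp
        ultimately show ?thesis by linarith
      qed
    qed
    then show ?thesis by (simp add: h)
  qed
  moreover have "m / \<tau> > 0" using m \<tau> by simp
  ultimately have "\<forall>\<^sub>F \<delta> in at_right 0. h \<delta> \<le> \<tau> * \<delta>"
    unfolding eventually_at_right_field by blast
  with \<tau> show ?thesis by blast
qed

text \<open>Substituting \<open>\<gamma> = 1 + t\<close> turns the infimum over
  \<open>\<gamma> \<ge> 1\<close> into \<open>l\<close> minus the conjugate at \<open>-l\<close>.
  The range \<open>\<gamma> < 1\<close> cannot go lower: there \<rho> vanishes and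
  \<open>\<gamma> * l \<ge> l\<close> as \<open>l \<le> 0\<close>.\<close>

lemma khat_eq:
  assumes nonneg: "\<And>t. 0 \<le> \<rho> t" and nonpos: "\<And>t. t \<le> 0 \<Longrightarrow> \<rho> t = 0"
    and h: "\<And>u. monotone_conj \<rho> u = ereal (h u)"
    and le: "lam g H t \<le> 0"
  shows "khat \<rho> g H t = ereal (lam g H t - h (- lam g H t))"
proof (rule antisym)
  define l where "l = lam g H t"
  have l: "l \<le> 0" using le by (simp add: l_def)
  have h0: "0 \<le> h (- l)"
    using monotone_conj_upper[of 0 "- l" \<rho>] nonpos[of 0] h[of "- l"] by simp
  have lower: "ereal (l - h (- l)) \<le> \<rho> (\<gamma> - 1) + ereal (\<gamma> * l)" if "\<gamma> \<ge> 0" for \<gamma>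
  proof (cases "\<gamma> \<ge> 1")
    case True
    show ?thesis
    proof (cases "\<rho> (\<gamma> - 1)")
      case (real r)
      then show ?thesis
        using monotone_conj_upper[of "\<gamma> - 1" "- l" \<rho>] True h[of "- l"] by (simp add: algebra_simps)
    qed (use nonneg[of "\<gamma> - 1"] in auto)
  next
    case False
    have "l \<le> \<gamma> * l" using mult_right_mono_neg[of \<gamma> 1 l] False l by simp
    then show ?thesis using False h0 nonpos[of "\<gamma> - 1"] by simp
  qed
  then show "ereal (lam g H t - h (- lam g H t)) \<le> khat \<rho> g H t"
    unfolding khat_def l_def[symmetric] by (intro INF_greatest) auto
  define k where "k = khat \<rho> g H t"
  have upper: "k \<le> \<rho> (\<gamma> - 1) + ereal (\<gamma> * l)" if "\<gamma> \<ge> 0" for \<gamma>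
    unfolding k_def khat_def l_def by (rule INF_lower) (simp add: that)
  have "ereal (l - h (- l)) \<le> k"
    unfolding k_def khat_def l_def[symmetric] by (rule INF_greatest) (use lower in auto)
  moreover have "k \<le> ereal l" using upper[of 1] nonpos[of 0] by simp
  ultimately obtain k' where k': "k = ereal k'" by (cases k) auto
  have "monotone_conj \<rho> (- l) \<le> ereal (l - k')"
  proof (rule monotone_conj_leI[OF _ nonneg])
    fix t r :: real assume "0 \<le> t" "\<rho> t = ereal r"
    then show "- l * t - r \<le> l - k'"
      using upper[of "1 + t"] k' by (simp add: algebra_simps)
  qed
  then show "khat \<rho> g H t \<le> ereal (lam g H t - h (- lam g H t))"
    using h[of "- l"] k' by (simp flip: l_def k_def)
qed

lemma khat_nonpos:
  assumes "\<And>t. t \<le> 0 \<Longrightarrow> \<rho> t = 0"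
  shows "khat \<rho> g H t \<le> 0"
  unfolding khat_def by (rule INF_lower2[of 0]) (simp_all add: assms)

subsection \<open>The pseudoinverse of a symmetric matrix\<close>

lemma matrix_add_rdistrib: "(B + C) ** A = B ** A + C ** (A :: real^'n^'m)"
  by (vector matrix_matrix_mult_def sum.distrib[symmetric] field_simps)

lemma matrix_sub_ldistrib: "A ** (B - C) = A ** B - A ** (C :: real^'n^'m)"
  by (vector matrix_matrix_mult_def sum_subtractf[symmetric] field_simps)

lemma matrix_sub_rdistrib: "(B - C) ** A = B ** A - C ** (A :: real^'n^'m)"
  by (vector matrix_matrix_mult_def sum_subtractf[symmetric] field_simps)

text \<open>With \<open>P\<close> the orthogonal projection onto the kernel of \<open>A\<close>, the matrix \<open>A + P\<close> is
  invertible and \<open>(A + P)\<^sup>-\<^sup>1 - P\<close> is the pseudoinverse of \<open>A\<close>.\<close>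

lemma symmetric_pinv_exists:
  fixes A :: "real^'n^'n"
  assumes sym: "transpose A = A"
  shows "\<exists>X. A ** X ** A = A \<and> X ** A ** X = X \<and>
    transpose (A ** X) = A ** X \<and> transpose (X ** A) = X ** A"
proof -
  define K where "K = {x. A *v x = 0}"
  have sub: "subspace K"
    by (auto simp: K_def subspace_def matrix_vector_right_distrib matrix_vector_mult_scaleR)
  obtain B where B: "B \<subseteq> K" "pairwise orthogonal B" "\<And>x. x \<in> B \<Longrightarrow> norm x = 1"
    "independent B" "span B = K"
    using orthonormal_basis_subspace[OF sub] by metis
  have fin: "finite B" using B(4) by (rule independent_imp_finite)
  define p where "p = (\<lambda>x. \<Sum>b\<in>B. (b \<bullet> x) *\<^sub>R b)"
  have lin: "linear p"
    unfolding p_def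
    by (auto intro!: linearI simp: inner_add_right scaleR_add_left sum.distrib scaleR_sum_right)
  define P where "P = matrix p"
  have Pv: "P *v x = p x" for x
    using matrix_works[of p x] lin by (simp add: P_def linear_matrix_vector_mul_eq)
  have pK: "p x \<in> K" for x
    unfolding p_def using B(1) by (intro subspace_sum[OF sub] subspace_scale[OF sub]) auto
  have pfix: "p x = x" if "x \<in> K" for x
  proof -
    have "p b = b" if b: "b \<in> B" for b
    proof -
      have "p b = (\<Sum>b'\<in>B. if b' = b then b else 0)"
        unfolding p_def
        by (rule sum.cong) (use B(2,3) b in \<open>auto simp: pairwise_def orthogonal_def norm_eq_1\<close>)
      also have "\<dots> = b" using b fin by simp
      finally show ?thesis .
    qed
    moreover have "x \<in> span B" using that B(5) by simp
    ultimately show ?thesis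
      using linear_eq_on_span[OF lin linear_ident] by blast
  qed
  have psym: "x \<bullet> p y = p x \<bullet> y" for x y
    by (simp add: p_def inner_sum_left inner_sum_right inner_commute mult.commute)
  have Psym: "transpose P = P"
  proof -
    have "transpose P *v x = P *v x" for x
    proof -
      have "(transpose P *v x) \<bullet> y = (P *v x) \<bullet> y" for y
        using psym[of x y] dot_lmul_matrix[of x P y] by (simp add: Pv)
      then show ?thesis using vector_eq_rdot by blast
    qed
    then show ?thesis by (simp add: matrix_eq)
  qed
  have AP: "A ** P = 0"
    using pK by (simp add: matrix_eq Pv K_def flip: matrix_vector_mul_assoc)
  have PA: "P ** A = 0"
    using arg_cong[OF AP, of transpose] by (simp add: matrix_transpose_mul sym Psym) (simp add: transpose_def vec_eq_iff)
  have PP: "P ** P = P"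
    using pfix[OF pK] by (simp add: matrix_eq Pv flip: matrix_vector_mul_assoc)
  \<comment> \<open>Applying \<open>P\<close> to \<open>(A + P) *v x = 0\<close> leaves
    \<open>P *v x = 0\<close>; hence \<open>A *v x = 0\<close>, so \<open>x\<close> lies in the
    kernel, where \<open>P\<close> is the identity.\<close>
  have inj: "x = 0" if "(A + P) *v x = 0" for x
  proof -
    have "P *v ((A + P) *v x) = P *v x"
      by (simp add: matrix_vector_mul_assoc matrix_add_ldistrib PA PP)
    with that have Px: "P *v x = 0" by simp
    with that have "x \<in> K" by (simp add: matrix_vector_mult_add_rdistrib K_def)
    with Px show ?thesis by (simp add: Pv pfix)
  qed
  then obtain M where M: "M ** (A + P) = mat 1"
    using matrix_left_invertible_ker[of "A + P"] by blast
  then have M': "(A + P) ** M = mat 1" using matrix_left_right_inverse by blast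
  have MP: "M ** P = P"
  proof -
    have "M ** P = M ** ((A + P) ** P)" by (simp add: matrix_add_rdistrib AP PP)
    also have "\<dots> = P" by (simp add: matrix_mul_assoc M)
    finally show ?thesis .
  qed
  have PM: "P ** M = P"
  proof -
    have "P ** M = (P ** (A + P)) ** M" by (simp add: matrix_add_ldistrib PA PP)
    also have "\<dots> = P" by (simp add: M' flip: matrix_mul_assoc)
    finally show ?thesis .
  qed
  have AM: "A ** M = mat 1 - P" using M' PM by (simp add: matrix_add_rdistrib algebra_simps)
  have MA: "M ** A = mat 1 - P" using M MP by (simp add: matrix_add_ldistrib algebra_simps)
  define X where "X = M - P"
  have AX: "A ** X = mat 1 - P" by (simp add: X_def matrix_sub_ldistrib AM AP)
  have XA: "X ** A = mat 1 - P" by (simp add: X_def matrix_sub_rdistrib MA PA)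
  have "transpose (mat 1 - P) = mat 1 - P"
    using Psym by (simp add: transpose_def vec_eq_iff mat_def)
  moreover have "(mat 1 - P) ** A = A" by (simp add: matrix_sub_rdistrib PA)
  moreover have "(mat 1 - P) ** X = X"
    by (simp add: X_def matrix_sub_rdistrib matrix_sub_ldistrib PM PP)
  ultimately have "A ** X ** A = A \<and> X ** A ** X = X \<and>
      transpose (A ** X) = A ** X \<and> transpose (X ** A) = X ** A"
    by (simp add: AX XA)
  then show ?thesis ..
qed

lemma penrose_unique:
  fixes A :: "real^'n^'m"
  assumes X: "A ** X ** A = A" "X ** A ** X = X" "transpose (A ** X) = A ** X" "transpose (X ** A) = X ** A"
    and Y: "A ** Y ** A = A" "Y ** A ** Y = Y" "transpose (A ** Y) = A ** Y" "transpose (Y ** A) = Y ** A"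
  shows "X = Y"
proof -
  \<comment> \<open>Both \<open>A ** X\<close> and \<open>A ** Y\<close> are symmetric, so
    transposing \<open>A ** Y ** A ** X = A ** X\<close> swaps the two factors, and the swapped
    product collapses to \<open>A ** Y\<close>.\<close>
  have "A ** X = transpose (A ** Y ** A ** X)" using X(3) Y(1) by simp
  also have "\<dots> = transpose (A ** X) ** transpose (A ** Y)"
    by (simp add: matrix_mul_assoc flip: matrix_transpose_mul)
  also have "\<dots> = A ** Y" using X(1,3) Y(3) by (simp add: matrix_mul_assoc)
  finally have AXY: "A ** X = A ** Y" .
  have "X ** A = transpose (X ** A ** (Y ** A))"
    using X(4) Y(1) by (metis matrix_mul_assoc)
  also have "\<dots> = transpose (Y ** A) ** transpose (X ** A)" by (rule matrix_transpose_mul)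
  also have "\<dots> = Y ** A" using X(1,4) Y(4) by (metis matrix_mul_assoc)
  finally have XYA: "X ** A = Y ** A" .
  show "X = Y" using X(2) Y(2) AXY XYA by (metis matrix_mul_assoc)
qed

lemma symmetric_pinv:
  fixes A :: "real^'n^'n"
  assumes "transpose A = A"
  shows "A ** pinv A ** A = A" "pinv A ** A ** pinv A = pinv A"
    "transpose (A ** pinv A) = A ** pinv A" "transpose (pinv A ** A) = pinv A ** A"
proof -
  have "\<exists>!X. A ** X ** A = A \<and> X ** A ** X = X \<and>
      transpose (A ** X) = A ** X \<and> transpose (X ** A) = X ** A"
    using symmetric_pinv_exists[OF assms] penrose_unique[of A] by blast
  from theI'[OF this] show "A ** pinv A ** A = A" "pinv A ** A ** pinv A = pinv A"
    "transpose (A ** pinv A) = A ** pinv A" "transpose (pinv A ** A) = pinv A ** A"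
    unfolding pinv_def by blast+
qed

text \<open>For symmetric \<open>A\<close>, the Penrose equations let a factor \<open>A\<close> be
  pulled out on the left of \<open>pinv A\<close>. The resulting preimage of
  \<open>pinv A *v g\<close> under \<open>A\<close> is the vector \<open>q\<close> required by
  \<open>lam_argmax_less\<close>.\<close>

lemma symmetric_pinv_solution:
  fixes A :: "real^'n^'n"
  assumes sym: "transpose A = A" and g: "g \<in> range (\<lambda>v. A *v v)"
  shows "A *v (pinv A *v g) = g" "pinv A *v g \<in> range (\<lambda>v. A *v v)"
proof -
  obtain v where v: "g = A *v v" using g by blast
  show "A *v (pinv A *v g) = g"
    using symmetric_pinv(1)[OF sym] unfolding v by (metis matrix_vector_mul_assoc)
  have "pinv A = transpose (pinv A ** A) ** pinv A"
    using symmetric_pinv(2,4)[OF sym] by simp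
  also have "\<dots> = A ** (transpose (pinv A) ** pinv A)"
    by (simp add: matrix_transpose_mul sym matrix_mul_assoc)
  finally show "pinv A *v g \<in> range (\<lambda>v. A *v v)"
    by (metis matrix_vector_mul_assoc rangeI)
qed

subsection \<open>Differentiability and maximizers\<close>

text \<open>By continuity \<open>lam\<close> stays negative near \<open>t\<close>, so
  \<open>khat_eq\<close> holds on a neighbourhood and the chain rule applies, with \<open>h\<close>
  differentiated at the positive point \<open>- lam g H t\<close>.\<close>

lemma khat_differentiable:
  assumes sym: "transpose H = H" and low: "\<And>x. c * (x \<bullet> x) \<le> x \<bullet> (H *v x)" and c: "c \<le> 0"
    and nonneg: "\<And>t. 0 \<le> \<rho> t" and nonpos: "\<And>t. t \<le> 0 \<Longrightarrow> \<rho> t = 0"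
    and h: "\<And>u. monotone_conj \<rho> u = ereal (h u)"
    and diff: "\<And>u. u > 0 \<Longrightarrow> ereal_differentiable_at (monotone_conj \<rho>) u"
    and lt: "lam g H t < c"
  shows "ereal_differentiable_at (khat \<rho> g H) t"
proof -
  have "\<forall>\<^sub>F u in nhds t. lam g H u < 0"
    using isCont_lam[OF sym, of t g] lt c
    by (simp add: continuous_within order_tendstoD eventually_nhds_conv_at)
  then have ev: "\<forall>\<^sub>F u in nhds t. khat \<rho> g H u = ereal (lam g H u - h (- lam g H u))"
    by eventually_elim (simp add: khat_eq[OF nonneg nonpos h])
  have "h differentiable at (- lam g H t)"
    using diff[of "- lam g H t"] lt c by (simp add: ereal_differentiable_at_def h)
  then obtain d where d: "(h has_real_derivative d) (at (- lam g H t))"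
    by (auto simp: real_differentiable_def)
  obtain l where l: "(lam g H has_real_derivative l) (at t)"
    using lam_differentiable[OF sym low lt] by (auto simp: real_differentiable_def)
  have "((\<lambda>u. lam g H u - h (- lam g H u)) has_real_derivative l - d * - l) (at t)"
    by (intro DERIV_diff l DERIV_chain2[where f = h and g = "\<lambda>u. - lam g H u", OF d] DERIV_minus)
  moreover have "\<forall>\<^sub>F u in nhds t. lam g H u - h (- lam g H u) = real_of_ereal (khat \<rho> g H u)"
    using ev by eventually_elim simp
  ultimately have "((\<lambda>u. real_of_ereal (khat \<rho> g H u)) has_real_derivative l - d * - l) (at t)"
    by (simp add: DERIV_cong_ev)
  moreover have "\<forall>\<^sub>F u in nhds t. \<bar>khat \<rho> g H u\<bar> \<noteq> \<infinity>"
    using ev by eventually_elim simp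
  ultimately show ?thesis
    by (auto simp: ereal_differentiable_at_def real_differentiable_def)
qed

text \<open>Moving \<open>t\<close> to the left of \<open>t\<^sub>0 = c + g\<^sup>T p\<close> is best parametrised by the value
  \<open>c - \<delta>\<close> of the smallest eigenvalue: then \<open>t = c - \<delta> + g\<^sup>T x\<close> with \<open>x\<close> the resolvent
  solution, and \<open>t\<^sub>0 - t = \<delta> (1 + x\<^sup>T p)\<close>. Optimality of \<open>tstar \<ge> t\<^sub>0\<close> would bound \<open>x\<^sup>T p\<close> by the
  difference quotient of the conjugate, while \<open>x \<rightarrow> p\<close> as \<open>\<delta> \<rightarrow> 0\<close>.\<close>

lemma lam_argmax_less:
  fixes H :: "real^'n^'n"
  assumes sym: "transpose H = H" and low: "\<And>x. c * (x \<bullet> x) \<le> x \<bullet> (H *v x)" and c: "c \<le> 0"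
    and nonneg: "\<And>t. 0 \<le> \<rho> t" and nonpos: "\<And>t. t \<le> 0 \<Longrightarrow> \<rho> t = 0"
    and h: "\<And>u. monotone_conj \<rho> u = ereal (h u)" and h0: "h 0 = 0"
    and p: "H *v p - c *\<^sub>R p = g" and q: "H *v q - c *\<^sub>R q = p"
    and slope: "\<forall>\<^sub>F \<delta> in at_right 0. h (- c + \<delta>) - h (- c) \<le> D * \<delta>" and D: "D < p \<bullet> p"
    and max: "\<And>t. khat \<rho> g H t - ereal t \<le> khat \<rho> g H tstar - ereal tstar"
    and top: "lam g H tstar \<le> c \<or> c = 0"
  shows "lam g H tstar < c"
proof (rule ccontr)
  assume "\<not> lam g H tstar < c"
  then have ge: "c \<le> lam g H tstar" by simp
  have tstar: "c + g \<bullet> p \<le> tstar"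
  proof (rule ccontr)
    \<comment> \<open>The test vector \<open>(1, -p)\<close> in \<open>lam_le\<close> gives
      \<open>c \<le> tstar - g \<bullet> p\<close>.\<close>
    assume "\<not> c + g \<bullet> p \<le> tstar"
    moreover have "H *v (- p) = - (H *v p)"
      using matrix_vector_mult_diff_distrib[of H 0 p] by simp
    moreover have "p \<bullet> (H *v p) = g \<bullet> p + c * (p \<bullet> p)"
      using arg_cong[OF p, of "inner p"] by (simp add: inner_diff_right inner_commute)
    moreover have "c * (1 + p \<bullet> p) \<le> lam g H tstar * (1 + p \<bullet> p)"
      using ge by (intro mult_right_mono) auto
    ultimately show False
      using lam_le[OF sym, of g tstar 1 "- p"] by (simp add: distrib_left)
  qed
  have khat_star: "khat \<rho> g H tstar \<le> ereal (c - h (- c))"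
  proof (cases "lam g H tstar \<le> c")
    case True
    with ge have "lam g H tstar = c" by simp
    then show ?thesis using khat_eq[OF nonneg nonpos h, of g H tstar] c by simp
  next
    case False
    with top have "c = 0" by simp
    \<comment> \<open>When \<open>c = 0\<close>, the eigenvalue at \<open>tstar\<close> may be
      positive, outside the range of \<open>khat_eq\<close>; the choice \<open>\<gamma> = 0\<close>
      still bounds \<open>khat\<close> by \<open>0 = c - h (- c)\<close>.\<close>
    then show ?thesis using khat_nonpos[where \<rho> = \<rho>, OF nonpos] h0 by (simp flip: zero_ereal_def)
  qed
  have main: "p \<bullet> p - 2 * \<delta> * norm q * norm p \<le> (h (- c + \<delta>) - h (- c)) / \<delta>" if \<delta>: "\<delta> > 0" for \<delta>
  proof -
    define s where "s = c - \<delta>"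
    have s: "s < c" "c - s = \<delta>" "- s = - c + \<delta>" using \<delta> by (simp_all add: s_def)
    obtain x where x: "H *v x - s *\<^sub>R x = g" using resolvent_exists[OF low s(1)] by blast
    define t where "t = s + g \<bullet> x"
    have "s * (y \<bullet> y) \<le> y \<bullet> (H *v y)" for y
      using low[of y] mult_right_mono[of s c "y \<bullet> y"] s by simp
    then have "lam g H t = s" by (rule lam_eqI[OF sym _ x t_def])
    then have "khat \<rho> g H t = ereal (s - h (- s))"
      using khat_eq[OF nonneg nonpos h, of g H t] s c by simp
    then have "ereal (s - h (- s) - t) \<le> khat \<rho> g H tstar - ereal tstar"
      using max[of t] by simp
    also have "\<dots> \<le> ereal (c - h (- c)) - ereal tstar"
      by (intro ereal_minus_mono khat_star) simp
    finally have "g \<bullet> p - g \<bullet> x \<le> h (- c + \<delta>) - h (- c)"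
      using tstar s(3) by (simp add: t_def)
    then have le: "\<delta> * (x \<bullet> p) \<le> h (- c + \<delta>) - h (- c)"
      using resolvent_inner_diff[OF sym x p] s by simp
    \<comment> \<open>This is the error of the first-order expansion
      \<open>x = p - \<delta> q + w\<close>. Its residual is of order \<delta> squared, which
      absorbs the factor \<delta> in \<open>resolvent_bound\<close>. Applied to \<open>x - p\<close>
      directly, that bound would give only \<open>norm (x - p) \<le> norm p\<close>; this is why
      \<open>p\<close> must have a preimage \<open>q\<close>.\<close>
    define w where "w = x - p + \<delta> *\<^sub>R q"
    have "H *v w - s *\<^sub>R w = (H *v x - s *\<^sub>R x) - (H *v p - s *\<^sub>R p) + \<delta> *\<^sub>R (H *v q - s *\<^sub>R q)"
      by (simp add: w_def matrix_vector_mult_diff_distrib matrix_vector_right_distrib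
          matrix_vector_mult_scaleR algebra_simps)
    also have "H *v p - s *\<^sub>R p = g + \<delta> *\<^sub>R p" using p by (auto simp: s_def algebra_simps)
    also have "H *v q - s *\<^sub>R q = p + \<delta> *\<^sub>R q" using q by (auto simp: s_def algebra_simps)
    finally have "H *v w - s *\<^sub>R w = (\<delta> * \<delta>) *\<^sub>R q" using x by (simp add: algebra_simps)
    then have "\<delta> * norm w \<le> \<delta> * (\<delta> * norm q)"
      using resolvent_bound[OF low, of s w] s by (simp add: mult.assoc)
    then have "norm w \<le> \<delta> * norm q" using \<delta> by simp
    moreover have "norm (x - p) \<le> norm w + norm (\<delta> *\<^sub>R q)"
      using norm_triangle_ineq4[of w "\<delta> *\<^sub>R q"] by (simp add: w_def)
    ultimately have "norm (x - p) \<le> 2 * \<delta> * norm q" using \<delta> by simp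
    then have "norm (x - p) * norm p \<le> 2 * \<delta> * norm q * norm p" by (rule mult_right_mono) simp
    moreover have "p \<bullet> p - x \<bullet> p \<le> norm (x - p) * norm p"
      using norm_cauchy_schwarz[of "p - x" p] by (simp add: inner_diff_left norm_minus_commute)
    ultimately have "p \<bullet> p - 2 * \<delta> * norm q * norm p \<le> x \<bullet> p" by simp
    also have "\<dots> \<le> (h (- c + \<delta>) - h (- c)) / \<delta>"
      using le \<delta> by (simp add: field_simps)
    finally show ?thesis .
  qed
  have "((\<lambda>\<delta>. p \<bullet> p - 2 * \<delta> * norm q * norm p) \<longlongrightarrow> p \<bullet> p - 2 * 0 * norm q * norm p) (at_right 0)"
    by (intro tendsto_intros)
  moreover have "\<forall>\<^sub>F \<delta> in at_right 0. p \<bullet> p - 2 * \<delta> * norm q * norm p \<le> D"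
    using slope eventually_at_right_less[of 0]
  proof eventually_elim
    case (elim \<delta>)
    then have "(h (- c + \<delta>) - h (- c)) / \<delta> \<le> D" by (simp add: field_simps)
    with main[OF elim(2)] show ?case by linarith
  qed
  ultimately have "p \<bullet> p \<le> D"
    using tendsto_upperbound[OF _ _ trivial_limit_at_right_real] by fastforce
  with D show False by simp
qed

theorem theorem3p10:
  fixes g :: "real^'n" and H :: "real^'n^'n" and \<rho> :: "real \<Rightarrow> ereal" and tstar :: real
  assumes g_nz: "g \<noteq> 0"
    and H_sym: "transpose H = H"
    and rho_nonneg: "\<And>t. 0 \<le> \<rho> t"
    and rho_pcc: "proper_closed_convex \<rho>"
    and rho_0: "\<rho> 0 = 0"
    and rho_mono: "mono \<rho>"
    and rho_nonpos: "\<And>t. t \<le> 0 \<Longrightarrow> \<rho> t = 0"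
    and rho_finite: "\<exists>t0>0. \<rho> t0 < \<infinity>"
    and rho_superlinear: "((\<lambda>t. \<rho> t / ereal t) \<longlongrightarrow> \<infinity>) at_top"
    and conj_diff: "\<And>t. t > 0 \<Longrightarrow> ereal_differentiable_at (monotone_conj \<rho>) t"
    and tstar_max: "is_arg_max (\<lambda>t. khat \<rho> g H t - ereal t) (\<lambda>_. True) tstar"
  shows "(positive_definite H \<and>
            \<not> is_arg_min \<rho> (\<lambda>_. True) ((norm (matrix_inv H *v g))\<^sup>2) \<longrightarrow>
          lam g H tstar < 0 \<and> ereal_differentiable_at (khat \<rho> g H) tstar) \<and>
         (lambda_min H \<le> 0 \<and>
            g \<in> range (\<lambda>v. (H - lambda_min H *\<^sub>R mat 1) *v v) \<and>
            norm (pinv (H - lambda_min H *\<^sub>R mat 1) *v g)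
              > sqrt (right_deriv (monotone_conj \<rho>) (- lambda_min H)) \<longrightarrow>
          lam g H tstar < lambda_min H \<and> ereal_differentiable_at (khat \<rho> g H) tstar)"
proof -
  obtain h where h: "\<And>u. monotone_conj \<rho> u = ereal (h u)" and h_nonneg: "\<And>u. 0 \<le> h u"
    and h_nonpos: "\<And>u. u \<le> 0 \<Longrightarrow> h u = 0"
    using monotone_conj_real[OF rho_nonneg rho_0 rho_superlinear] by blast
  have max: "khat \<rho> g H t - ereal t \<le> khat \<rho> g H tstar - ereal tstar" for t
    using tstar_max by (auto simp: is_arg_max_def not_less)
  \<comment> \<open>Both parts are instances: \<open>c = 0\<close> with \<open>p\<close> and
    \<open>q\<close> obtained by applying the inverse of \<open>H\<close> once and twice to
    \<open>g\<close>, and \<open>c = lambda_min H\<close> with \<open>p\<close> given by the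
    pseudoinverse.\<close>
  have result: "lam g H tstar < c \<and> ereal_differentiable_at (khat \<rho> g H) tstar"
    if "\<And>x. c * (x \<bullet> x) \<le> x \<bullet> (H *v x)" "c \<le> 0"
      "H *v p - c *\<^sub>R p = g" "H *v q - c *\<^sub>R q = p"
      "\<forall>\<^sub>F \<delta> in at_right 0. h (- c + \<delta>) - h (- c) \<le> D * \<delta>" "D < p \<bullet> p"
      "lam g H tstar \<le> c \<or> c = 0" for c p q D
  proof -
    have "lam g H tstar < c"
      by (rule lam_argmax_less[OF H_sym that(1,2) rho_nonneg rho_nonpos h h_nonpos that(3-6) max that(7)])
        simp_all
    with khat_differentiable[OF H_sym that(1,2) rho_nonneg rho_nonpos h conj_diff] show ?thesis
      by blast
  qed
  show ?thesis
  proof (intro conjI[of "_ \<longrightarrow> _"] impI; elim conjE)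
    assume pd: "positive_definite H"
      and arg: "\<not> is_arg_min \<rho> (\<lambda>_. True) ((norm (matrix_inv H *v g))\<^sup>2)"
    have low: "0 * (x \<bullet> x) \<le> x \<bullet> (H *v x)" for x
      using pd by (cases "x = 0") (auto simp: positive_definite_def intro: less_imp_le)
    have "x = 0" if "H *v x = 0" for x
      using pd that by (force simp: positive_definite_def)
    then have "invertible H" by (simp add: invertible_left_inverse matrix_left_invertible_ker)
    then have "H ** matrix_inv H = mat 1"
      unfolding invertible_def matrix_inv_def by (rule someI2_ex) simp
    then have inv: "H *v (matrix_inv H *v y) = y" for y
      by (simp add: matrix_vector_mul_assoc)
    define p where "p = matrix_inv H *v g"
    have "p \<noteq> 0" using inv[of g] g_nz by (auto simp: p_def)
    then have pp: "0 < p \<bullet> p" by simp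
    \<comment> \<open>As \<rho> is nonnegative with \<open>\<rho> 0 = 0\<close>, its minimizers are
      exactly its zeros.\<close>
    have "\<rho> (p \<bullet> p) \<noteq> 0"
      using arg rho_nonneg by (auto simp: is_arg_min_def p_def dot_square_norm not_less)
    then have "0 < \<rho> (p \<bullet> p)" using rho_nonneg[of "p \<bullet> p"] by (simp add: less_le)
    then obtain D where D: "D < p \<bullet> p" "\<forall>\<^sub>F \<delta> in at_right 0. h \<delta> \<le> D * \<delta>"
      using monotone_conj_slope_at_0[OF _ _ rho_nonneg rho_0 h pp] rho_pcc
      by (auto simp: proper_closed_convex_def)
    show "lam g H tstar < 0 \<and> ereal_differentiable_at (khat \<rho> g H) tstar"
      by (rule result[OF low, of p "matrix_inv H *v p" D])
        (use D inv h_nonpos[of 0] in \<open>simp_all add: p_def\<close>)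
  next
    define c where "c = lambda_min H"
    define A where "A = H - c *\<^sub>R mat 1"
    assume c: "lambda_min H \<le> 0"
      and range: "g \<in> range (\<lambda>v. (H - lambda_min H *\<^sub>R mat 1) *v v)"
      and gt: "norm (pinv (H - lambda_min H *\<^sub>R mat 1) *v g)
        > sqrt (right_deriv (monotone_conj \<rho>) (- lambda_min H))"
    have Av: "A *v x = H *v x - c *\<^sub>R x" for x
      by (simp add: A_def matrix_vector_mult_diff_rdistrib scaleR_matrix_vector_assoc[symmetric])
    have Asym: "transpose A = A"
      using H_sym by (simp add: A_def transpose_def vec_eq_iff mat_def)
    define p where "p = pinv A *v g"
    have gA: "g \<in> range (\<lambda>v. A *v v)" using range by (simp add: A_def c_def)
    have p: "A *v p = g" unfolding p_def by (rule symmetric_pinv_solution(1)[OF Asym gA])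
    have "p \<in> range (\<lambda>v. A *v v)" unfolding p_def by (rule symmetric_pinv_solution(2)[OF Asym gA])
    then obtain q where q: "A *v q = p" by auto
    define d where "d = right_deriv (monotone_conj \<rho>) (- c)"
    have "sqrt d < norm p" using gt by (simp add: d_def c_def p_def A_def)
    \<comment> \<open>\<open>sqrt\<close> is strictly increasing on all reals, negative ones
      included, so the sign of \<open>d\<close> does not matter.\<close>
    then have "d < p \<bullet> p" by (simp add: norm_eq_sqrt_inner)
    then obtain D where D: "d < D" "D < p \<bullet> p" using dense by blast
    have low: "c * (x \<bullet> x) \<le> x \<bullet> (H *v x)" for x
      unfolding c_def by (rule lambda_min_symmetric(1)[OF H_sym])
    have "\<exists>d. (h has_real_derivative d) (at_right (- c))"
    proof (cases "c = 0")
      case True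
      then show ?thesis
        using monotone_conj_right_deriv_at_0[OF rho_nonneg h h_nonneg] h_nonpos[of 0] by simp
    next
      case False
      then have "h differentiable at (- c)"
        using conj_diff[of "- c"] c by (simp add: ereal_differentiable_at_def h c_def)
      then show ?thesis
        by (meson real_differentiable_def has_field_derivative_at_within)
    qed
    then have "(h has_real_derivative d) (at_right (- c))"
      unfolding d_def by (rule monotone_conj_right_deriv[OF h])
    then have slope: "\<forall>\<^sub>F \<delta> in at_right 0. h (- c + \<delta>) - h (- c) \<le> D * \<delta>"
      using D(1) by (rule right_derivative_increment_le)
    obtain v where v: "v \<noteq> 0" "H *v v = c *\<^sub>R v"
      unfolding c_def using lambda_min_symmetric(2)[OF H_sym] by blast
    have "lam g H tstar \<le> c"
    proof -
      \<comment> \<open>The test vector \<open>(0, v)\<close>, with \<open>v\<close> a minimal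
        eigenvector of \<open>H\<close>, never sees \<open>t\<close> or \<open>g\<close>.\<close>
      have "lam g H tstar * (v \<bullet> v) \<le> c * (v \<bullet> v)"
        using lam_le[OF H_sym, of g tstar 0 v] v by simp
      then show ?thesis using v by (simp add: mult_le_cancel_right_pos)
    qed
    then have "lam g H tstar < c \<and> ereal_differentiable_at (khat \<rho> g H) tstar"
      using p q by (intro result[OF low _ _ _ slope D(2)]) (simp_all add: c c_def[symmetric] Av c[folded c_def])
    then show "lam g H tstar < lambda_min H \<and> ereal_differentiable_at (khat \<rho> g H) tstar"
      by (simp add: c_def)
  qed
qed

end
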